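(* Let $d\ge1$ be an integer. For every integer $k$ with $0\le k\le d$, the following identity holds in $\mathbb{Q}(v)$: $$\sum_{s=0}^k\frac{v^{(1-d)(d-s)}(v^{d-s+1}+v^{s-d-1})(v^{d-s+2}+v^{s-d-2})\cdots(v^d+v^{-d})}{[s]!}(v-v^{-1})^{d-s}$$ $$=v^{d(k+1-d)}(v-v^{-1})^{d-k}\,\frac{(v^{d-k}+v^{k-d})(v^{d-k+1}+v^{k-d-1})\cdots(v^{d-1}+v^{1-d})}{[k]!}.$$ Here the product in the $s$-th summand on the left is $\prod_{j=d-s+1}^{d}(v^j+v^{-j})$ and the product on the right is $\prod_{j=d-k}^{d-1}(v^j+v^{-j})$ (empty products are $1$).
   Context: $v$ is an indeterminate, $[m]=\frac{v^m-v^{-m}}{v-v^{-1}}$ and $[r]!=\prod_{i=1}^r[i]$ for $r\ge0$. *)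

theory Defs
  imports Complex_Main "HOL-Computational_Algebra.Computational_Algebra"
begin

text \<open>The field of rational functions over the rationals in one indeterminate is the
  fraction field of the polynomial ring.\<close>

type_synonym ratfun = "rat poly fract"

definition v :: ratfun where
  "v = Fract [:0, 1:] 1"

definition qint :: "int \<Rightarrow> ratfun" where
  "qint m = (v powi m - v powi (- m)) / (v - inverse v)"

definition qfact :: "nat \<Rightarrow> ratfun" where
  "qfact r = (\<Prod>i = 1..r. qint (int i))"

end

theory Submission
  imports Defs
begin

text \<open>The right-hand side, as a function of \<open>k\<close>, is the sequence of partial sums of the left-hand
  side, so the proof is by induction on \<open>k\<close>; for \<open>k = 0\<close> there is a single summand, and it is the
  right-hand side. For \<open>k < d\<close> put \<open>m = d - k - 1\<close>. The right-hand sides at \<open>k\<close> and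
  \<open>k + 1\<close> and the new summand all contain the factor
  \<open>v powi (- d * m) * (v - inverse v) ^ m * (\<Prod>j = m + 1..d - 1. v powi j + v powi (- j)) / [k + 1]!\<close>.
  Removing it turns the induction step into
  \<open>(v powi (k + 1) - v powi (- k - 1)) + v powi m * (v powi d + v powi (- d))
    = v powi d * (v powi m + v powi (- m))\<close>.
  Here \<open>v powi (d + m)\<close> occurs on both sides, and the remaining terms cancel because
  \<open>d - m = k + 1\<close>; this is \<open>telescoping_step\<close>.  Removing the factor uses \<open>[k + 1] \<noteq> 0\<close>, which
  holds because the indeterminate \<open>v\<close> is not a root of unity (\<open>v_power_eq_1_iff\<close>).\<close>

lemma v_power: "v ^ n = Fract (monom 1 n) 1"
  by (induction n)
     (simp_all add: v_def One_fract_def monom_Suc)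

lemma v_nonzero: "v \<noteq> 0"
  by (simp add: v_def Zero_fract_def eq_fract)

lemma v_power_eq_1_iff: "v ^ n = 1 \<longleftrightarrow> n = 0"
  by (simp add: v_power One_fract_def eq_fract monom_eq_1_iff)

lemma v_powi_diff_nonzero:
  assumes "n > 0"
  shows "v powi int n - v powi (- int n) \<noteq> 0"
proof
  assume "v powi int n - v powi (- int n) = 0"
  then have "v ^ (n + n) = 1"
    using v_nonzero by (simp add: power_int_minus power_add field_simps)
  with assms show False
    by (simp add: v_power_eq_1_iff)
qed

lemma v_minus_inverse_nonzero: "v - inverse v \<noteq> 0"
  using v_powi_diff_nonzero[of 1] by (simp add: power_int_minus)

lemma qint_nonzero: "n > 0 \<Longrightarrow> qint (int n) \<noteq> 0"
  using v_powi_diff_nonzero[of n] v_minus_inverse_nonzero by (simp add: qint_def)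

lemma qfact_Suc: "qfact (Suc r) = qfact r * qint (int (Suc r))"
  by (simp add: qfact_def)

text \<open>After division by \<open>x powi (- d * m)\<close> this is
  \<open>(x powi (d - m) - x powi (m - d)) + (x powi (d + m) + x powi (m - d))
    = x powi (d + m) + x powi (d - m)\<close>.
  The induction step uses it with \<open>m = d - k - 1\<close>, so that \<open>d - m = k + 1\<close> and the first bracket
  is \<open>(v - inverse v) * [k + 1]\<close>.\<close>

lemma telescoping_step:
  fixes x :: "'a::field" and d m :: int
  assumes "x \<noteq> 0"
  shows "x powi (d * (- m)) * (x powi (d - m) - x powi (- (d - m)))
           + x powi ((1 - d) * m) * (x powi d + x powi (- d))
         = x powi (d * (1 - m)) * (x powi m + x powi (- m))"
proof -
  have split: "x powi ((1 - d) * m) = x powi (d * (- m)) * x powi m"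
              "x powi (d * (1 - m)) = x powi (d * (- m)) * x powi d"
    using assms by (simp_all add: algebra_simps flip: power_int_add)
  have "(x powi (d - m) - x powi (- (d - m))) + x powi m * (x powi d + x powi (- d))
          = x powi d * (x powi m + x powi (- m))"
    using assms by (simp add: algebra_simps flip: power_int_add)
  then show ?thesis
    unfolding split by (simp only: mult.assoc flip: distrib_left)
qed

theorem proposition4p4:
  fixes d k :: nat
  assumes "d \<ge> 1" and "k \<le> d"
  shows
    "(\<Sum>s = 0..k.
        v powi ((1 - int d) * (int d - int s))
        * (\<Prod>j = int d - int s + 1..int d. v powi j + v powi (- j))
        / qfact s
        * (v - inverse v) ^ (d - s))
     = v powi (int d * (int k + 1 - int d))
       * (v - inverse v) ^ (d - k)
       * ((\<Prod>j = int d - int k..int d - 1. v powi j + v powi (- j)) / qfact k)"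
  using assms(2)
proof (induction k)
  case 0
  show ?case
    by (simp add: qfact_def mult.commute)
next
  case (Suc k)
  define f where "f = (\<lambda>j. v powi j + v powi (- j))"
  define m where "m = int d - int k - 1"
  define P where "P = prod f {int d - int k..int d - 1}"
  define u where "u = v - inverse v"
  define U where "U = u ^ (d - Suc k)"
  define q where "q = qint (int (Suc k))"
  have q: "q \<noteq> 0"
    unfolding q_def by (rule qint_nonzero) simp
  have u_q: "u * q = v powi (int d - m) - v powi (- (int d - m))"
  proof -
    have "int d - m = int (Suc k)"
      by (simp add: m_def)
    then show ?thesis
      using v_minus_inverse_nonzero by (simp only: u_def q_def qint_def) simp
  qed
  have U: "u ^ (d - k) = u * U"
    using Suc.prems by (simp add: U_def Suc_diff_Suc flip: power_Suc)
  have "{int d - int k..int d} = insert (int d) {int d - int k..int d - 1}"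
    by auto
  then have new: "prod f {int d - int (Suc k) + 1..int d} = f (int d) * P"
    by (simp add: P_def)
  have "{int d - int (Suc k)..int d - 1} = insert m {int d - int k..int d - 1}"
    using Suc.prems by (auto simp: m_def)
  then have goal: "prod f {int d - int (Suc k)..int d - 1} = f m * P"
    by (simp add: P_def m_def)
  have exps: "int k + 1 - int d = - m" "int d - int (Suc k) = m" "int (Suc k) + 1 - int d = 1 - m"
    by (simp_all add: m_def)
  have "v powi (int d * (- m)) * (u * U) * (P / qfact k)
          + v powi ((1 - int d) * m) * (f (int d) * P) / (qfact k * q) * U
        = (v powi (int d * (- m)) * (u * q) + v powi ((1 - int d) * m) * f (int d))
            * (U * P / (qfact k * q))"
    using q by (simp add: add_divide_distrib distrib_right mult.assoc)
  also have "\<dots> = v powi (int d * (1 - m)) * f m * (U * P / (qfact k * q))"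
    unfolding u_q f_def telescoping_step[OF v_nonzero] ..
  also have "\<dots> = v powi (int d * (1 - m)) * U * ((f m * P) / (qfact k * q))"
    by simp
  finally have step: "v powi (int d * (- m)) * (u * U) * (P / qfact k)
          + v powi ((1 - int d) * m) * (f (int d) * P) / (qfact k * q) * U
        = v powi (int d * (1 - m)) * U * ((f m * P) / (qfact k * q))" .
  have IH: "(\<Sum>s = 0..k. v powi ((1 - int d) * (int d - int s))
        * prod f {int d - int s + 1..int d} / qfact s * u ^ (d - s))
      = v powi (int d * (- m)) * (u * U) * (P / qfact k)"
    using Suc.IH Suc.prems unfolding f_def[symmetric] u_def[symmetric] P_def[symmetric] U exps(1)
    by simp
  show ?case
    unfolding f_def[symmetric] u_def[symmetric] sum.atLeast0_atMost_Suc IH new goal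
      qfact_Suc q_def[symmetric] U_def[symmetric]
    unfolding exps(2,3)
    by (rule step)
qed

end
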